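(* Let $\mathcal{T}$ be a sparse tensor of order $d$, with $d$ treated as an $\mathcal{O}(1)$ constant, and let $N_0=\mathrm{nnz}(\mathcal{T})$ and, for $s\ge1$, $N_s=\max_{i_1,\ldots,i_s}\mathrm{nnz}(\mathcal{T}_{i_1,\ldots,i_s,\ldots})$. Assume: (A1) $\mathcal{T}$ has shape $n\times\cdots\times n$ ($d$ modes) and the SatID target rank is $(k,\ldots,k)$; (A2) $k(N_1+\cdots+N_d)=\mathcal{O}(N_0)$. Let $m$ be an upper bound for the sketch dimensions. Then the sketched marginalized norm sampling algorithm for selecting the index set $J_d$ of a SatID of $\mathcal{T}$ (described in the context) runs with complexity $\mathcal{O}(\mathrm{nnz}(\mathcal{T})+mn^2k^2)$. (If (A2) does not hold, the complexity is $\mathcal{O}(N_0+k(N_1+\cdots+N_d)+mn^2k^2)$.)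
   Context: $\mathrm{nnz}$ is the number of nonzero entries; $\mathcal{T}_{i_1,\ldots,i_s,\ldots}$ is the slice with the first $s$ indices fixed. Complexity counts arithmetic operations; a count sketch (a linear map with one nonzero entry per column) is applied to a sparse array $\mathcal{Y}$ in $\mathcal{O}(\mathrm{nnz}(\mathcal{Y}))$ operations. $\mathrm{mat}_{d,\cdot}\mathcal{T}$ has rows indexed by mode $d$ and columns indexed by the other modes; $\mathrm{mat}_{\cdot,s}$ has columns indexed by mode $s$ and rows indexed by the other modes. $S\times_{s+1,\ldots,d-1}\mathcal{Y}$ denotes applying $S$ to modes $s+1,\ldots,d-1$ jointly, turning them into a single mode of size at most $m$; $\times_dQ$ contracts mode $d$ with the row index of $Q$. SatID seeks, for each mode $j$, a set $J_j$ of $k$ column indices of $\mathrm{mat}_{j,\cdot}\mathcal{T}$. The task here is to select $J_d$, i.e. $k$ column multi-indices $(i_1,\ldots,i_{d-1})$ of $A=\mathrm{mat}_{d,\cdot}\mathcal{T}$, by norm sampling: given the selected set $I$ and an orthonormal basis $Q$ of the span of the columns $A_{:,I}$, the next column is sampled with probability (approximately) proportional to its residual squared norm $\|A_{:,\mathbf{i}}\|^2-\|Q^\top A_{:,\mathbf{i}}\|^2$. Algorithm. If sketching does not reduce the complexity, use the direct method (maintain all nonzero column scores of $A$ explicitly, updating each by subtracting $(q^\top A_{:,\mathbf{i}})^2$ whenever a new orthonormal direction $q$ is added; cost $\mathcal{O}(kN_0)$ in total). Otherwise, start with $Q=\emptyset$, generate a count sketch $S$, compute once $\widehat{\mathcal{T}}=S\times_{2,\ldots,d-1}\mathcal{T}$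 and the scores $d_j=\|(\mathrm{mat}_{\cdot,1}\widehat{\mathcal{T}})_{:,j}\|^2$, $j\in[n]$. Then repeat $k$ times: (a) sample $i_1$ with probability proportional to $d_j$, and set $\mathcal{T}'=\mathcal{T}_{i_1,\ldots}$ (modes numbered $2,\ldots,d$); (b) for $s=2,\ldots,d-1$: either switch to the direct method on $\mathcal{T}'$, computing the residual squared norms of all nonzero columns of $\mathrm{mat}_{d,\cdot}\mathcal{T}'$ with respect to $Q$ and sampling $(i_s,\ldots,i_{d-1})$ at once (then leave the loop), or generate a count sketch $S$, compute $\widehat{\mathcal{T}}'=S\times_{s+1,\ldots,d-1}\mathcal{T}'$, compute the scores $\|(\mathrm{mat}_{\cdot,s}\widehat{\mathcal{T}}')_{:,j}\|^2-\|(\mathrm{mat}_{\cdot,s}(\widehat{\mathcal{T}}'\times_dQ))_{:,j}\|^2$ for $j\in[n]$, sample $i_s$ with probability proportional to them, and replace $\mathcal{T}'$ by its slice at $i_s$ (modes numbered $s+1,\ldots,d$); (c) add $(i_1,\ldots,i_{d-1})$ to $J_d$; orthonormalize the new column $\mathcal{T}_{i_1,\ldots,i_{d-1},:}$ against $Q$ to get $q$, append $q$ to $Q$, and update $d_j\leftarrow d_j-\|q^\top(\mathrm{mat}_{\cdot,1}\widehat{\mathcal{T}})_{:,j}\|^2$, where $q$ is contracted with mode $d$. The mode $s$ at which to switch to the direct method in (b) is chosen so as to minimize the total cost. *)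

theory Defs
  imports "HOL-Probability.Probability_Mass_Function" "HOL-Library.Monad_Syntax"
begin

section \<open>Sparse arrays\<close>

text \<open>
  An array is a function into the reals that vanishes outside a finite index set.  A tensor is
  indexed by lists, the entry at position \<open>s - 1\<close> of the list being the index of mode \<open>s\<close>.
  Indices range over \<open>{..<n}\<close>.
\<close>

type_synonym tensor = "nat list \<Rightarrow> real"

definition multi_indices :: "nat \<Rightarrow> nat \<Rightarrow> nat list set" where
  "multi_indices n p = {is. length is = p \<and> set is \<subseteq> {..<n}}"

definition cubic_tensor :: "nat \<Rightarrow> nat \<Rightarrow> tensor \<Rightarrow> bool" where
  "cubic_tensor n d T \<longleftrightarrow> {is. T is \<noteq> 0} \<subseteq> multi_indices n d"

definition nnz :: "('i \<Rightarrow> real) \<Rightarrow> nat" where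
  "nnz Y = card {i. Y i \<noteq> 0}"

definition slice :: "tensor \<Rightarrow> nat list \<Rightarrow> tensor" where
  "slice T is = (\<lambda>js. T (is @ js))"

definition max_slice_nnz :: "nat \<Rightarrow> tensor \<Rightarrow> nat \<Rightarrow> nat" where
  "max_slice_nnz n T s = Max ((\<lambda>is. nnz (slice T is)) ` multi_indices n s)"

text \<open>
  A sketch of \<open>p\<close> joint modes is a matrix whose columns are indexed by \<open>multi_indices n p\<close>
  and whose rows are numbered below \<open>m\<close>.  A sketch with fewer than \<open>m\<close> rows is covered by the
  same predicate, since its missing rows are zero.
\<close>

type_synonym sketch = "nat \<Rightarrow> nat list \<Rightarrow> real"

definition count_sketch :: "nat \<Rightarrow> nat \<Rightarrow> nat \<Rightarrow> sketch \<Rightarrow> bool" where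
  "count_sketch m n p S \<longleftrightarrow> (\<forall>c \<in> multi_indices n p. \<exists>r<m. {r'. S r' c \<noteq> 0} = {r})"


section \<open>Counting arithmetic operations\<close>

text \<open>
  A counted value is paired with the number of real arithmetic operations spent on it.  Sums and
  tabulations are taken over the stored (nonzero) entries of sparse arrays, so that
  multiplications by structural zeros are neither performed nor counted.
\<close>

type_synonym 'a counted = "'a \<times> nat"

definition free :: "'a \<Rightarrow> 'a counted" where
  "free x = (x, 0)"

definition cbind :: "'a counted \<Rightarrow> ('a \<Rightarrow> 'b counted) \<Rightarrow> 'b counted" where
  "cbind x f = (fst (f (fst x)), snd x + snd (f (fst x)))"

definition ctimes :: "real counted \<Rightarrow> real counted \<Rightarrow> real counted" (infixl "\<otimes>" 70) where
  "x \<otimes> y = (fst x * fst y, snd x + snd y + 1)"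

definition cminus :: "real counted \<Rightarrow> real counted \<Rightarrow> real counted" (infixl "\<ominus>" 65) where
  "x \<ominus> y = (fst x - fst y, snd x + snd y + 1)"

definition cdivide :: "real counted \<Rightarrow> real counted \<Rightarrow> real counted" (infixl "\<oslash>" 70) where
  "x \<oslash> y = (fst x / fst y, snd x + snd y + 1)"

definition croot :: "real counted \<Rightarrow> real counted" where
  "croot x = (sqrt (fst x), snd x + 1)"

definition csum :: "'i set \<Rightarrow> ('i \<Rightarrow> real counted) \<Rightarrow> real counted" where
  "csum A f = (\<Sum>i\<in>A. fst (f i), \<Sum>i\<in>A. snd (f i) + 1)"

definition tabulate :: "'i set \<Rightarrow> ('i \<Rightarrow> real counted) \<Rightarrow> ('i \<Rightarrow> real) counted" where
  "tabulate A f = (\<lambda>i. if i \<in> A then fst (f i) else 0, \<Sum>i\<in>A. snd (f i))"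

text \<open>A randomized computation yields a distribution of counted values.\<close>

type_synonym 'a run = "'a counted pmf"

definition counted_run :: "'a counted \<Rightarrow> 'a run" where
  "counted_run x = return_pmf x"

definition random_choice :: "'a pmf \<Rightarrow> 'a run" where
  "random_choice p = map_pmf free p"

definition run_bind :: "'a run \<Rightarrow> ('a \<Rightarrow> 'b run) \<Rightarrow> 'b run" where
  "run_bind p f = bind_pmf p (\<lambda>(x, c). map_pmf (\<lambda>(y, c'). (y, c + c')) (f x))"

no_adhoc_overloading Monad_Syntax.bind \<rightleftharpoons> bind_pmf
adhoc_overloading Monad_Syntax.bind \<rightleftharpoons> cbind run_bind

abbreviation done_with :: "'a \<Rightarrow> 'a run" where
  "done_with x \<equiv> counted_run (free x)"

definition worst_case_cost :: "'a run \<Rightarrow> enat" where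
  "worst_case_cost p = (SUP r \<in> set_pmf p. enat (snd r))"

text \<open>
  Sampling from \<open>B\<close> with probability proportional to the scores \<open>w\<close>, which are stored on
  \<open>J \<subseteq> B\<close> and are zero elsewhere.  Forming the cumulative sums, scaling a uniform random number
  and searching take \<open>2 |J| + 1\<close> operations.  Proportional sampling is meaningless if all scores
  vanish; the sample is then taken uniformly from \<open>B\<close>.  Scores are never negative, because \<open>Q\<close>
  is orthonormal; the sign condition only makes the definition total.
\<close>

definition sample :: "'c set \<Rightarrow> 'c set \<Rightarrow> ('c \<Rightarrow> real) \<Rightarrow> 'c run" where
  "sample J B w = map_pmf (\<lambda>c. (c, 2 * card J + 1))
     (if (\<forall>c\<in>J. 0 \<le> w c) \<and> 0 < sum w J
      then embed_pmf (\<lambda>c. if c \<in> J then w c / sum w J else 0)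
      else pmf_of_set B)"

lemma pmf_fst_sample:
  assumes "finite J" "\<And>c. c \<in> J \<Longrightarrow> 0 \<le> w c" "0 < sum w J"
  shows "pmf (map_pmf fst (sample J B w)) c = (if c \<in> J then w c / sum w J else 0)"
proof -
  let ?g = "\<lambda>c. if c \<in> J then w c / sum w J else 0"
  have "(\<integral>\<^sup>+ c. ennreal (?g c) \<partial>count_space UNIV)
      = (\<Sum>c\<in>J. ennreal (?g c))"
    by (rule nn_integral_count_space'[OF assms(1)]) (use assms in auto)
  also have "\<dots> = ennreal (\<Sum>c\<in>J. w c / sum w J)"
    using assms by (subst sum_ennreal) auto
  also have "\<dots> = 1"
    using assms(3) by (simp add: sum_divide_distrib[symmetric])
  finally have 1: "(\<integral>\<^sup>+ c. ennreal (?g c) \<partial>count_space UNIV) = 1" .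
  have "pmf (embed_pmf ?g) c = ?g c"
    by (rule pmf_embed_pmf[OF _ 1]) (use assms in auto)
  then show ?thesis
    using assms by (simp add: sample_def pmf.map_comp o_def)
qed


section \<open>Building blocks of norm sampling\<close>

text \<open>
  The norm computations below work on arrays indexed by triples \<open>(c, r, l)\<close>: \<open>c\<close> is the
  index to be sampled, \<open>r\<close> the sketched mode and \<open>l\<close> the index of mode \<open>d\<close>.  For
  \<open>X\<close> with modes \<open>s, \<dots>, d\<close>, the function \<open>apply_sketch S X\<close> applies \<open>S\<close> to modes
  \<open>s + 1, \<dots>, d - 1\<close>, and \<open>unsketched X\<close> takes all of \<open>s, \<dots>, d - 1\<close> as the index \<open>c\<close>, with
  a trivial middle mode.
\<close>

definition apply_sketch :: "sketch \<Rightarrow> tensor \<Rightarrow> (nat \<times> nat \<times> nat \<Rightarrow> real) counted" where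
  "apply_sketch S X =
     tabulate {(j, r, l). \<exists>c. S r c \<noteq> 0 \<and> X (j # c @ [l]) \<noteq> 0}
       (\<lambda>(j, r, l). csum {c. S r c \<noteq> 0 \<and> X (j # c @ [l]) \<noteq> 0}
                        (\<lambda>c. free (S r c) \<otimes> free (X (j # c @ [l]))))"

definition unsketched :: "tensor \<Rightarrow> (nat list \<times> unit \<times> nat \<Rightarrow> real)" where
  "unsketched X = (\<lambda>(c, _, l). X (c @ [l]))"

definition nonzero_columns :: "tensor \<Rightarrow> nat list set" where
  "nonzero_columns X = {c. \<exists>l. X (c @ [l]) \<noteq> 0}"

definition column_sqnorm :: "('c \<times> 'r \<times> nat \<Rightarrow> real) \<Rightarrow> 'c \<Rightarrow> real counted" where
  "column_sqnorm Y c = csum {(r, l). Y (c, r, l) \<noteq> 0} (\<lambda>(r, l). free (Y (c, r, l)) \<otimes> free (Y (c, r, l)))"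

text \<open>\<open>Y \<times>\<^sub>d Q\<close>, where the list \<open>Q\<close> holds the columns of an \<open>n\<close>-row matrix.\<close>

definition contract ::
  "(nat \<Rightarrow> real) list \<Rightarrow> ('c \<times> 'r \<times> nat \<Rightarrow> real) \<Rightarrow> ('c \<times> 'r \<times> nat \<Rightarrow> real) counted" where
  "contract Q Y =
     tabulate {(c, r, a). a < length Q \<and> (\<exists>l. Y (c, r, l) \<noteq> 0)}
       (\<lambda>(c, r, a). csum {l. Y (c, r, l) \<noteq> 0} (\<lambda>l. free (Y (c, r, l)) \<otimes> free ((Q ! a) l)))"

definition initial_scores :: "'c set \<Rightarrow> ('c \<times> 'r \<times> nat \<Rightarrow> real) \<Rightarrow> ('c \<Rightarrow> real) counted" where
  "initial_scores J Y = tabulate J (column_sqnorm Y)"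

definition residual_scores ::
  "'c set \<Rightarrow> (nat \<Rightarrow> real) list \<Rightarrow> ('c \<times> 'r \<times> nat \<Rightarrow> real) \<Rightarrow> ('c \<Rightarrow> real) counted" where
  "residual_scores J Q Y = do {
     Z \<leftarrow> contract Q Y;
     tabulate J (\<lambda>c. column_sqnorm Y c \<ominus> column_sqnorm Z c)
   }"

definition update_scores ::
  "'c set \<Rightarrow> (nat \<Rightarrow> real) \<Rightarrow> ('c \<times> 'r \<times> nat \<Rightarrow> real) \<Rightarrow> ('c \<Rightarrow> real) \<Rightarrow> ('c \<Rightarrow> real) counted" where
  "update_scores J q Y w = do {
     Z \<leftarrow> contract [q] Y;
     tabulate J (\<lambda>c. free (w c) \<ominus> column_sqnorm Z c)
   }"

text \<open>
  Since \<open>x / 0 = 0\<close>, the result is the zero vector if \<open>v\<close> lies in the span of \<open>Q\<close>; then there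
  is no new direction.
\<close>

definition orthonormalize :: "nat \<Rightarrow> (nat \<Rightarrow> real) list \<Rightarrow> (nat \<Rightarrow> real) \<Rightarrow> (nat \<Rightarrow> real) counted" where
  "orthonormalize n Q v = do {
     g \<leftarrow> tabulate {..<length Q} (\<lambda>a. csum {..<n} (\<lambda>l. free ((Q ! a) l) \<otimes> free (v l)));
     u \<leftarrow> tabulate {..<n} (\<lambda>l. free (v l) \<ominus> csum {..<length Q} (\<lambda>a. free (g a) \<otimes> free ((Q ! a) l)));
     \<rho> \<leftarrow> croot (csum {..<n} (\<lambda>l. free (u l) \<otimes> free (u l)));
     tabulate {..<n} (\<lambda>l. free (u l) \<oslash> free \<rho>)
   }"

text \<open>
  The loop state consists of the selected multi-indices, the basis \<open>Q\<close>, and the maintained scores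
  of the array \<open>Y\<close>; \<open>extend\<close> adds the newly sampled multi-index \<open>i\<close> to it.
\<close>

type_synonym 'c loop_state = "nat list list \<times> (nat \<Rightarrow> real) list \<times> ('c \<Rightarrow> real)"

definition extend ::
  "nat \<Rightarrow> tensor \<Rightarrow> 'c set \<Rightarrow> ('c \<times> 'r \<times> nat \<Rightarrow> real) \<Rightarrow> nat list \<Rightarrow> 'c loop_state \<Rightarrow> 'c loop_state counted" where
  "extend n T J Y i = (\<lambda>(Js, Q, w). do {
     q \<leftarrow> orthonormalize n Q (\<lambda>l. T (i @ [l]));
     if q = (\<lambda>_. 0) then free (Js @ [i], Q, w)
     else do {
       w' \<leftarrow> update_scores J q Y w;
       free (Js @ [i], Q @ [q], w')
     }
   })"


section \<open>The direct method\<close>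

primrec direct_rounds ::
  "nat \<Rightarrow> nat \<Rightarrow> tensor \<Rightarrow> nat list loop_state \<Rightarrow> nat \<Rightarrow> nat list loop_state run" where
  "direct_rounds n d T st 0 = done_with st"
| "direct_rounds n d T st (Suc t) = do {
     (Js, Q, w) \<leftarrow> direct_rounds n d T st t;
     i \<leftarrow> sample (nonzero_columns T) (multi_indices n (d - 1)) w;
     counted_run (extend n T (nonzero_columns T) (unsketched T) i (Js, Q, w))
   }"

definition direct_method :: "nat \<Rightarrow> nat \<Rightarrow> nat \<Rightarrow> tensor \<Rightarrow> nat list list run" where
  "direct_method n d k T = do {
     w \<leftarrow> counted_run (initial_scores (nonzero_columns T) (unsketched T));
     (Js, Q, w') \<leftarrow> direct_rounds n d T ([], [], w) k;
     done_with Js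
   }"


section \<open>The sketched method\<close>

text \<open>
  In \<open>sample_modes\<close>, \<open>X\<close> has modes \<open>s, \<dots>, d\<close>, of which the first \<open>p = d - s\<close> remain to be sampled.
  The direct method takes over at mode \<open>sw\<close>; with \<open>sw = d\<close> it never does.  \<open>gen s\<close> is the
  distribution of the count sketch of modes \<open>s + 1, \<dots>, d - 1\<close>.
\<close>

primrec sample_modes ::
  "nat \<Rightarrow> (nat \<Rightarrow> sketch pmf) \<Rightarrow> nat \<Rightarrow> (nat \<Rightarrow> real) list \<Rightarrow> nat \<Rightarrow> nat \<Rightarrow> tensor \<Rightarrow> nat list run" where
  "sample_modes n gen sw Q 0 s X = done_with []"
| "sample_modes n gen sw Q (Suc p) s X =
     (if s = sw then do {
        w \<leftarrow> counted_run (residual_scores (nonzero_columns X) Q (unsketched X));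
        sample (nonzero_columns X) (multi_indices n (Suc p)) w
      } else do {
        S \<leftarrow> random_choice (gen s);
        Y \<leftarrow> counted_run (apply_sketch S X);
        w \<leftarrow> counted_run (residual_scores {..<n} Q Y);
        i \<leftarrow> sample {..<n} {..<n} w;
        is \<leftarrow> sample_modes n gen sw Q p (Suc s) (slice X [i]);
        done_with (i # is)
      })"

text \<open>
  \<open>gen t s\<close> is the distribution of the sketch generated for mode \<open>s\<close> in repetition \<open>t\<close>;
  \<open>gen 0 1\<close> is that of the sketch generated once at the start.
\<close>

primrec sketched_rounds ::
  "nat \<Rightarrow> nat \<Rightarrow> tensor \<Rightarrow> (nat \<Rightarrow> nat \<Rightarrow> sketch pmf) \<Rightarrow> nat \<Rightarrow> (nat \<times> nat \<times> nat \<Rightarrow> real)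
     \<Rightarrow> nat loop_state \<Rightarrow> nat \<Rightarrow> nat loop_state run" where
  "sketched_rounds n d T gen sw Y st 0 = done_with st"
| "sketched_rounds n d T gen sw Y st (Suc t) = do {
     (Js, Q, w) \<leftarrow> sketched_rounds n d T gen sw Y st t;
     i \<leftarrow> sample {..<n} {..<n} w;
     is \<leftarrow> sample_modes n (gen (Suc t)) sw Q (d - 2) 2 (slice T [i]);
     counted_run (extend n T {..<n} Y (i # is) (Js, Q, w))
   }"

definition sketched_method ::
  "nat \<Rightarrow> nat \<Rightarrow> nat \<Rightarrow> tensor \<Rightarrow> (nat \<Rightarrow> nat \<Rightarrow> sketch pmf) \<Rightarrow> nat \<Rightarrow> nat list list run" where
  "sketched_method n d k T gen sw = do {
     S \<leftarrow> random_choice (gen 0 1);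
     Y \<leftarrow> counted_run (apply_sketch S T);
     w \<leftarrow> counted_run (initial_scores {..<n} Y);
     (Js, Q, w') \<leftarrow> sketched_rounds n d T gen sw Y ([], [], w) k;
     done_with Js
   }"

text \<open>
  The cost of a run depends on the sampled indices and sketches, so the switch mode (\<open>d\<close> standing
  for no switch) and the use of the direct method are decided by the worst case over all runs.
\<close>

definition best_switch_mode :: "nat \<Rightarrow> nat \<Rightarrow> nat \<Rightarrow> tensor \<Rightarrow> (nat \<Rightarrow> nat \<Rightarrow> sketch pmf) \<Rightarrow> nat" where
  "best_switch_mode n d k T gen =
     arg_min_on (\<lambda>sw. worst_case_cost (sketched_method n d k T gen sw)) {2..d}"

definition sketched_marginalized_norm_sampling ::
  "nat \<Rightarrow> nat \<Rightarrow> nat \<Rightarrow> tensor \<Rightarrow> (nat \<Rightarrow> nat \<Rightarrow> sketch pmf) \<Rightarrow> nat list list run" where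
  "sketched_marginalized_norm_sampling n d k T gen =
     (let sketched = sketched_method n d k T gen (best_switch_mode n d k T gen)
      in if worst_case_cost (direct_method n d k T) \<le> worst_case_cost sketched
         then direct_method n d k T
         else sketched)"

definition sketch_generator :: "nat \<Rightarrow> nat \<Rightarrow> nat \<Rightarrow> (nat \<Rightarrow> nat \<Rightarrow> sketch pmf) \<Rightarrow> bool" where
  "sketch_generator m n d gen \<longleftrightarrow>
     (\<forall>t s. 1 \<le> s \<and> s < d \<longrightarrow> (\<forall>S \<in> set_pmf (gen t s). count_sketch m n (d - 1 - s) S))"

end

theory Submission
  imports Defs
begin

text \<open>
  Which of the candidate procedures is executed is decided by minimizing the worst-case cost, so
  every run costs at most as much as the most expensive run of any one candidate.  The candidate
  that sketches every mode and never switches to the direct method already meets the bound, so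
  analyzing that one suffices (\<open>sampling_cost_le_unswitched\<close>).

  Its analysis rests on two facts about \<open>Y\<close>, the result of applying a count sketch to a tensor
  \<open>X\<close>.  Each column of the sketch has a single nonzero entry, hence each stored entry of
  \<open>X\<close> enters one sum only: \<open>Y\<close> is computed in \<open>2 nnz X\<close> operations.  And \<open>Y\<close> has
  shape \<open>n \<times> m \<times> n\<close>, so that \<open>nnz Y \<le> m n\<^sup>2\<close> (both in \<open>apply_sketch_bounds\<close>); together
  with \<open>|Q| \<le> k\<close> this makes the scores computable in \<open>O(k m n\<^sup>2)\<close> operations.
  The sketch of \<open>T\<close> is formed once, for \<open>O(N\<^sub>0)\<close>.  In each of the \<open>k\<close> rounds, the tensor that is sketched after \<open>s\<close> indices have been
  fixed is a slice with at most \<open>N\<^sub>s\<close> stored entries, whichever indices were drawn.  A round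
  thus costs \<open>O(N\<^sub>1 + \<dots> + N\<^sub>d + k m n\<^sup>2)\<close>; the update of the basis and of the maintained scores,
  which takes \<open>O(k n + m n\<^sup>2)\<close>, is absorbed.  Summing over the rounds gives
  \<open>O(N\<^sub>0 + k (N\<^sub>1 + \<dots> + N\<^sub>d) + m n\<^sup>2 k\<^sup>2)\<close> for every outcome of the random choices
  (\<open>sketched_method_cost_le\<close>), where the hypothesis on the slices turns the middle term into
  \<open>O(N\<^sub>0)\<close>.
\<close>

section \<open>Cost bounds valid for every run\<close>

text \<open>
  The bound on the operations is coupled with a property of the result, because the cost of later
  steps depends on earlier results: on the sparsity of a sketched array, on the size of \<open>Q\<close>.
\<close>

definition runs_within :: "nat \<Rightarrow> ('a \<Rightarrow> bool) \<Rightarrow> 'a run \<Rightarrow> bool" where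
  "runs_within B P p \<longleftrightarrow> (\<forall>(x, c) \<in> set_pmf p. P x \<and> c \<le> B)"

lemma runs_within_bind:
  assumes "runs_within B P p" "\<And>x. P x \<Longrightarrow> runs_within B' R (f x)"
  shows "runs_within (B + B') R (run_bind p f)"
  using assms unfolding runs_within_def run_bind_def
  by (fastforce intro: add_mono)

lemma runs_within_mono:
  "runs_within B P p \<Longrightarrow> B \<le> B' \<Longrightarrow> runs_within B' P p"
  unfolding runs_within_def by fastforce

lemma runs_within_counted_run:
  "snd x \<le> B \<Longrightarrow> P (fst x) \<Longrightarrow> runs_within B P (counted_run x)"
  unfolding runs_within_def counted_run_def by auto

lemma runs_within_done_with: "P x \<Longrightarrow> runs_within 0 P (done_with x)"
  by (rule runs_within_counted_run) (simp_all add: free_def)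

lemma runs_within_random_choice:
  "(\<And>x. x \<in> set_pmf p \<Longrightarrow> P x) \<Longrightarrow> runs_within 0 P (random_choice p)"
  unfolding runs_within_def random_choice_def free_def by auto

lemma runs_within_sample: "runs_within (2 * card J + 1) (\<lambda>_. True) (sample J B w)"
  unfolding runs_within_def sample_def by auto

lemma worst_case_cost_le:
  assumes "runs_within B P p"
  shows "worst_case_cost p \<le> enat B"
  using assms unfolding worst_case_cost_def runs_within_def
  by (intro SUP_least) auto

lemma cost_le_worst_case_cost:
  "r \<in> set_pmf p \<Longrightarrow> enat (snd r) \<le> worst_case_cost p"
  unfolding worst_case_cost_def by (rule SUP_upper)


section \<open>Minimizing over the candidate procedures\<close>

lemma sampling_cost_le_unswitched:
  assumes "2 \<le> d" "r \<in> set_pmf (sketched_marginalized_norm_sampling n d k T gen)"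
  shows "enat (snd r) \<le> worst_case_cost (sketched_method n d k T gen d)"
proof -
  let ?f = "\<lambda>sw. worst_case_cost (sketched_method n d k T gen sw)"
  have "?f (best_switch_mode n d k T gen) \<le> ?f d"
    unfolding best_switch_mode_def
    by (rule arg_min_least) (use assms(1) in auto)
  moreover have "enat (snd r) \<le> ?f (best_switch_mode n d k T gen)"
    using cost_le_worst_case_cost[OF assms(2)]
    unfolding sketched_marginalized_norm_sampling_def Let_def
    by (auto split: if_splits intro: order_trans)
  ultimately show ?thesis
    by (rule order_trans[rotated])
qed


section \<open>Slices of sparse tensors\<close>

lemma finite_multi_indices: "finite (multi_indices n p)"
  using finite_lists_length_eq[of "{..<n}" p] by (simp add: multi_indices_def conj_commute)

lemma cubic_tensor_finite_support: "cubic_tensor n p T \<Longrightarrow> finite {is. T is \<noteq> 0}"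
  unfolding cubic_tensor_def using finite_multi_indices finite_subset by blast

lemma slice_slice: "slice (slice T is) js = slice T (is @ js)"
  by (simp add: slice_def)

lemma cubic_tensor_slice:
  "cubic_tensor n (length is + p) T \<Longrightarrow> cubic_tensor n p (slice T is)"
  by (fastforce simp: cubic_tensor_def slice_def multi_indices_def)

text \<open>
  A slice at a multi-index outside the shape of the tensor is zero, so the maximum over the
  multi-indices within the shape bounds it as well: the bound is valid for whatever indices a run
  draws.
\<close>

lemma nnz_slice_le:
  assumes "cubic_tensor n d T"
  shows "nnz (slice T is) \<le> max_slice_nnz n T (length is)"
proof (cases "is \<in> multi_indices n (length is)")
  case True
  then show ?thesis
    unfolding max_slice_nnz_def by (auto intro!: Max_ge finite_multi_indices)
next
  case False
  then have "{js. slice T is js \<noteq> 0} = {}"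
    using assms by (fastforce simp: cubic_tensor_def slice_def multi_indices_def)
  then show ?thesis
    by (simp add: nnz_def)
qed


section \<open>The cost of the building blocks\<close>

lemma snd_csum_products:
  "snd (csum A (\<lambda>i. free (f i) \<otimes> free (g i))) = 2 * card A"
  by (simp add: csum_def ctimes_def free_def)

text \<open>
  A stored entry \<open>X (j # c @ [l])\<close> determines the row \<open>r\<close> with \<open>S r c \<noteq> 0\<close>.  Hence the products
  formed are at most as many as the stored entries of \<open>X\<close>, and so are the sums.
\<close>

lemma apply_sketch_bounds:
  assumes S: "count_sketch m n p S" and X: "cubic_tensor n (Suc (Suc p)) X"
  shows "snd (apply_sketch S X) \<le> 2 * nnz X"
    and "finite {i. fst (apply_sketch S X) i \<noteq> 0}"
    and "nnz (fst (apply_sketch S X)) \<le> nnz X"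
    and "nnz (fst (apply_sketch S X)) \<le> m * n\<^sup>2"
proof -
  define A where "A = {(j, r, l). \<exists>c. S r c \<noteq> 0 \<and> X (j # c @ [l]) \<noteq> 0}"
  define D where "D = (\<lambda>(j, r, l). {c. S r c \<noteq> 0 \<and> X (j # c @ [l]) \<noteq> 0})"
  define h where "h = (\<lambda>((j, r :: nat, l), c). j # c @ [l :: nat])"
  have range: "j < n \<and> l < n \<and> c \<in> multi_indices n p" if "X (j # c @ [l]) \<noteq> 0" for j c l
    using X that by (fastforce simp: cubic_tensor_def multi_indices_def)
  have row: "r < m \<and> (\<forall>r'. S r' c \<noteq> 0 \<longrightarrow> r' = r)" if nz: "S r c \<noteq> 0" and c: "c \<in> multi_indices n p" for r c
  proof -
    obtain r0 where "r0 < m" "{r'. S r' c \<noteq> 0} = {r0}"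
      using S c unfolding count_sketch_def by blast
    then show ?thesis
      using nz by (auto simp: set_eq_iff)
  qed
  have inj: "inj_on h (Sigma A D)"
    using range row by (fastforce simp: inj_on_def h_def D_def)
  have sub: "h ` Sigma A D \<subseteq> {is. X is \<noteq> 0}"
    by (auto simp: h_def D_def)
  have finX: "finite {is. X is \<noteq> 0}"
    using X by (rule cubic_tensor_finite_support)
  have card: "card (Sigma A D) \<le> nnz X"
    unfolding nnz_def using card_inj_on_le[OF inj sub finX] .
  have finSig: "finite (Sigma A D)"
    using inj sub finX by (rule inj_on_finite)
  have A_box: "A \<subseteq> {..<n} \<times> {..<m} \<times> {..<n}"
    using range row by (fastforce simp: A_def)
  have finA: "finite A"
    using A_box by (rule finite_subset) auto
  have D_fin: "finite (D a)" if "a \<in> A" for a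
  proof -
    have "D a = snd ` (Sigma A D \<inter> {a} \<times> UNIV)"
      using that by force
    then show ?thesis
      using finSig by simp
  qed
  have "snd (apply_sketch S X) = (\<Sum>a\<in>A. 2 * card (D a))"
    unfolding apply_sketch_def tabulate_def A_def D_def
    by (auto intro!: sum.cong simp: snd_csum_products)
  also have "\<dots> = 2 * card (Sigma A D)"
    using finA D_fin by (simp add: card_SigmaI sum_distrib_left)
  finally show "snd (apply_sketch S X) \<le> 2 * nnz X"
    using card by simp
  have supp: "{i. fst (apply_sketch S X) i \<noteq> 0} \<subseteq> A"
    by (auto simp: apply_sketch_def tabulate_def A_def split: if_splits)
  then show "finite {i. fst (apply_sketch S X) i \<noteq> 0}"
    using finA by (rule finite_subset)
  have nnz_A: "nnz (fst (apply_sketch S X)) \<le> card A"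
    unfolding nnz_def using finA supp by (rule card_mono)
  have "A \<subseteq> fst ` Sigma A D"
    by (force simp: A_def D_def)
  then have "card A \<le> card (Sigma A D)"
    by (rule surj_card_le[OF finSig])
  with nnz_A card show "nnz (fst (apply_sketch S X)) \<le> nnz X"
    by linarith
  have "card A \<le> card ({..<n} \<times> {..<m} \<times> {..<n})"
    using A_box by (rule card_mono[rotated]) auto
  with nnz_A show "nnz (fst (apply_sketch S X)) \<le> m * n\<^sup>2"
    by (simp add: card_cartesian_product power2_eq_square mult.left_commute)
qed

text \<open>The columns of \<open>Y\<close> have disjoint sets of stored entries.\<close>

lemma sum_column_sqnorm_cost_le:
  assumes J: "finite J" and Y: "finite {i. Y i \<noteq> 0}"
  shows "(\<Sum>c\<in>J. snd (column_sqnorm Y c)) \<le> 2 * nnz Y"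
proof -
  let ?E = "\<lambda>c. {(r, l). Y (c, r, l) \<noteq> 0}"
  have sub: "Sigma J ?E \<subseteq> {i. Y i \<noteq> 0}"
    by auto
  have fin: "finite (?E c)" for c
    by (rule finite_subset[OF _ finite_imageI[OF Y, of snd]]) force
  have cost: "snd (column_sqnorm Y c) = 2 * card (?E c)" for c
    by (simp add: column_sqnorm_def case_prod_unfold snd_csum_products)
  have "(\<Sum>c\<in>J. snd (column_sqnorm Y c)) = 2 * card (Sigma J ?E)"
    using J fin by (simp add: cost card_SigmaI sum_distrib_left)
  also have "\<dots> \<le> 2 * nnz Y"
    unfolding nnz_def using card_mono[OF Y sub] by simp
  finally show ?thesis .
qed

lemma initial_scores_cost_le:
  assumes "finite J" "finite {i. Y i \<noteq> 0}"
  shows "snd (initial_scores J Y) \<le> 2 * nnz Y"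
  using sum_column_sqnorm_cost_le[OF assms] by (simp add: initial_scores_def tabulate_def)

text \<open>Each stored entry of \<open>Y\<close> is multiplied once with each column of \<open>Q\<close>.\<close>

lemma contract_bounds:
  fixes Y :: "'c \<times> 'r \<times> nat \<Rightarrow> real"
  assumes Y: "finite {i. Y i \<noteq> 0}"
  shows "snd (contract Q Y) \<le> 2 * (length Q * nnz Y)"
    and "finite {i. fst (contract Q Y) i \<noteq> 0}"
    and "nnz (fst (contract Q Y)) \<le> length Q * nnz Y"
proof -
  define A where "A = {(c :: 'c, r :: 'r, a). a < length Q \<and> (\<exists>l. Y (c, r, l) \<noteq> 0)}"
  define D where "D = (\<lambda>(c :: 'c, r :: 'r, a :: nat). {l. Y (c, r, l) \<noteq> 0})"
  define h where "h = (\<lambda>((c :: 'c, r :: 'r, a :: nat), l :: nat). (a, (c, r, l)))"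
  let ?P = "{..<length Q} \<times> {i. Y i \<noteq> 0}"
  have finP: "finite ?P" and cardP: "card ?P = length Q * nnz Y"
    using Y by (simp_all add: card_cartesian_product nnz_def)
  have inj: "inj_on h (Sigma A D)"
    by (auto simp: inj_on_def h_def)
  have sub: "h ` Sigma A D \<subseteq> ?P"
    by (auto simp: h_def A_def D_def)
  have A_sub: "A \<subseteq> (\<lambda>(a, (c, r, l)). (c, r, a)) ` ?P"
    by (force simp: A_def)
  have finA: "finite A"
    using finP A_sub by (rule finite_surj)
  have cardA: "card A \<le> length Q * nnz Y"
    using surj_card_le[OF finP A_sub] cardP by simp
  have D_fin: "finite (D a)" for a
    by (rule finite_subset[OF _ finite_imageI[OF Y, of "snd \<circ> snd"]]) (force simp: D_def)
  have "snd (contract Q Y) = (\<Sum>a\<in>A. 2 * card (D a))"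
    unfolding contract_def tabulate_def A_def D_def
    by (auto intro!: sum.cong simp: snd_csum_products)
  also have "\<dots> = 2 * card (Sigma A D)"
    using finA D_fin by (simp add: card_SigmaI sum_distrib_left)
  also have "\<dots> \<le> 2 * (length Q * nnz Y)"
    using card_inj_on_le[OF inj sub finP] cardP by simp
  finally show "snd (contract Q Y) \<le> 2 * (length Q * nnz Y)" .
  have supp: "{i. fst (contract Q Y) i \<noteq> 0} \<subseteq> A"
    by (auto simp: contract_def tabulate_def A_def split: if_splits)
  then show "finite {i. fst (contract Q Y) i \<noteq> 0}"
    using finA by (rule finite_subset)
  show "nnz (fst (contract Q Y)) \<le> length Q * nnz Y"
    using card_mono[OF finA supp] cardA by (simp add: nnz_def)
qed

lemma residual_scores_cost_le:
  assumes J: "finite J" and Y: "finite {i. Y i \<noteq> 0}"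
  shows "snd (residual_scores J Q Y) \<le> (4 * length Q + 2) * nnz Y + card J"
proof -
  let ?Z = "fst (contract Q Y)"
  have "snd (residual_scores J Q Y)
      = snd (contract Q Y) + ((\<Sum>c\<in>J. snd (column_sqnorm Y c)) + (\<Sum>c\<in>J. snd (column_sqnorm ?Z c)) + card J)"
    by (simp add: residual_scores_def cbind_def tabulate_def cminus_def sum.distrib sum_Suc)
  also have "\<dots> \<le> 2 * (length Q * nnz Y) + (2 * nnz Y + 2 * nnz ?Z + card J)"
    by (intro add_mono contract_bounds(1) sum_column_sqnorm_cost_le J Y contract_bounds(2) order_refl)
  also have "\<dots> \<le> (4 * length Q + 2) * nnz Y + card J"
    using contract_bounds(3)[OF Y, of Q] by (simp add: algebra_simps)
  finally show ?thesis .
qed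

lemma update_scores_cost_le:
  assumes J: "finite J" and Y: "finite {i. Y i \<noteq> 0}"
  shows "snd (update_scores J q Y w) \<le> 4 * nnz Y + card J"
proof -
  let ?Z = "fst (contract [q] Y)"
  have "snd (update_scores J q Y w) = snd (contract [q] Y) + ((\<Sum>c\<in>J. snd (column_sqnorm ?Z c)) + card J)"
    by (simp add: update_scores_def cbind_def tabulate_def cminus_def free_def sum.distrib sum_Suc)
  also have "\<dots> \<le> 2 * (length [q] * nnz Y) + (2 * nnz ?Z + card J)"
    by (intro add_mono contract_bounds(1) sum_column_sqnorm_cost_le J Y contract_bounds(2) order_refl)
  also have "\<dots> \<le> 4 * nnz Y + card J"
    using contract_bounds(3)[OF Y, of "[q]"] by simp
  finally show ?thesis .
qed

lemma orthonormalize_cost: "snd (orthonormalize n Q v) = 4 * n * length Q + 4 * n + 1"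
  by (simp add: orthonormalize_def cbind_def tabulate_def cminus_def croot_def cdivide_def
      snd_csum_products) (simp add: free_def algebra_simps)

lemma extend_bounds:
  assumes "finite J" "finite {i. Y i \<noteq> 0}"
  shows "snd (extend n T J Y i (Js, Q, w)) \<le> 4 * n * length Q + 4 * n + 1 + (4 * nnz Y + card J)"
    and "length (fst (snd (fst (extend n T J Y i (Js, Q, w))))) \<le> Suc (length Q)"
  using update_scores_cost_le[OF assms]
  by (auto simp: extend_def cbind_def free_def orthonormalize_cost)


section \<open>The cost of the sketched method\<close>

text \<open>
  With \<open>is\<close> already drawn, the tensor has order \<open>length is + Suc p\<close>, and this order as the switch
  mode stands for never switching.  A mode costs the sketch of the current slice, the residual
  scores of the sketched array with its at most \<open>m n\<^sup>2\<close> entries, and \<open>3 n + 1\<close>: \<open>n\<close>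
  subtractions of squared norms and \<open>2 n + 1\<close> operations for the draw.
\<close>

lemma sample_modes_cost_le:
  assumes T: "cubic_tensor n (length is + Suc p) T"
    and gen: "\<And>s S. 1 \<le> s \<Longrightarrow> s < length is + Suc p \<Longrightarrow> S \<in> set_pmf (gen s) \<Longrightarrow>
                count_sketch m n (length is + p - s) S"
  shows "runs_within
           (2 * (\<Sum>v = length is..<length is + p. max_slice_nnz n T v)
              + p * ((4 * length Q + 2) * (m * n\<^sup>2) + 3 * n + 1))
           (\<lambda>_. True)
           (sample_modes n gen (length is + Suc p) Q p (Suc (length is)) (slice T is))"
  using assms
proof (induction p arbitrary: "is")
  case 0
  show ?case
    by (simp add: runs_within_done_with)
next
  case (Suc p)
  let ?X = "slice T is" and ?c = "(4 * length Q + 2) * (m * n\<^sup>2) + 3 * n + 1"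
  let ?N = "max_slice_nnz n T"
  let ?rest = "2 * (\<Sum>v = Suc (length is)..<Suc (length is) + p. ?N v) + p * ?c"
  let ?s = "Suc (length is)" and ?d = "length is + Suc (Suc p)"
  have unswitched: "?s \<noteq> ?d"
    by simp
  have X: "cubic_tensor n (Suc (Suc p)) ?X"
    using Suc.prems(1) by (rule cubic_tensor_slice)
  have rest: "runs_within ?rest (\<lambda>_. True) (sample_modes n gen ?d Q p (Suc ?s) (slice ?X [i]))" for i
    using Suc.IH[of "is @ [i]"] Suc.prems by (simp add: slice_slice)
  have sketch: "runs_within 0 (count_sketch m n p) (random_choice (gen ?s))"
    using Suc.prems(2)[of ?s] by (intro runs_within_random_choice) auto
  have sketched: "runs_within (2 * ?N (length is))
      (\<lambda>Y. finite {i. Y i \<noteq> 0} \<and> nnz Y \<le> m * n\<^sup>2) (counted_run (apply_sketch S ?X))"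
    if "count_sketch m n p S" for S
    using apply_sketch_bounds[OF that X] nnz_slice_le[OF Suc.prems(1), of "is"]
    by (intro runs_within_counted_run) auto
  have scores: "runs_within ((4 * length Q + 2) * (m * n\<^sup>2) + n) (\<lambda>_. True)
      (counted_run (residual_scores {..<n} Q Y))"
    if "finite {i. Y i \<noteq> 0} \<and> nnz Y \<le> m * n\<^sup>2" for Y :: "nat \<times> nat \<times> nat \<Rightarrow> real"
  proof (rule runs_within_counted_run)
    have "snd (residual_scores {..<n} Q Y) \<le> (4 * length Q + 2) * nnz Y + n"
      using residual_scores_cost_le[of "{..<n}" Y Q] that by simp
    also have "\<dots> \<le> (4 * length Q + 2) * (m * n\<^sup>2) + n"
      using that by (intro add_mono mult_le_mono) auto
    finally show "snd (residual_scores {..<n} Q Y) \<le> (4 * length Q + 2) * (m * n\<^sup>2) + n" .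
  qed simp
  have "runs_within
      (0 + (2 * ?N (length is) + (((4 * length Q + 2) * (m * n\<^sup>2) + n)
         + ((2 * card {..<n} + 1) + (?rest + 0)))))
      (\<lambda>_. True) (sample_modes n gen ?d Q (Suc p) ?s ?X)"
    unfolding sample_modes.simps if_not_P[OF unswitched]
    by (intro runs_within_bind[OF sketch] runs_within_bind[OF sketched]
        runs_within_bind[OF scores] runs_within_bind[OF runs_within_sample]
        runs_within_bind[OF rest] runs_within_done_with TrueI)
  then show ?case
    by (rule runs_within_mono) (simp add: sum.atLeast_Suc_lessThan algebra_simps)
qed

text \<open>
  The basis grows by at most one column per round, so \<open>length Q \<le> k\<close> throughout the \<open>k\<close> rounds.
\<close>

lemma sketched_rounds_cost_le:
  assumes d: "2 \<le> d" and T: "cubic_tensor n d T" and gen: "sketch_generator m n d gen"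
    and Y: "finite {i. Y i \<noteq> 0}" "nnz Y \<le> m * n\<^sup>2" and t: "t \<le> k"
  shows "runs_within
      (t * (2 * n + 1
        + (2 * (\<Sum>s = 1..<d - 1. max_slice_nnz n T s)
            + (d - 2) * ((4 * k + 2) * (m * n\<^sup>2) + 3 * n + 1))
        + (4 * n * k + 4 * n + 1 + (4 * (m * n\<^sup>2) + n))))
      (\<lambda>(Js, Q, w). length Q \<le> t)
      (sketched_rounds n d T gen d Y ([], [], w) t)"
  using t
proof (induction t)
  case 0
  show ?case
    by (simp add: runs_within_done_with)
next
  case (Suc t)
  let ?b = "2 * (\<Sum>s = 1..<d - 1. max_slice_nnz n T s)
              + (d - 2) * ((4 * k + 2) * (m * n\<^sup>2) + 3 * n + 1)"
  let ?e = "4 * n * k + 4 * n + 1 + (4 * (m * n\<^sup>2) + n)"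
  let ?r = "2 * n + 1 + ?b + ?e"
  have IH: "runs_within (t * ?r) (\<lambda>(Js, Q, w). length Q \<le> t) (sketched_rounds n d T gen d Y ([], [], w) t)"
    using Suc by simp
  have modes: "runs_within ?b (\<lambda>_. True) (sample_modes n (gen (Suc t)) d Q (d - 2) 2 (slice T [i]))"
    if "length Q \<le> t" for Q :: "(nat \<Rightarrow> real) list" and i
  proof -
    have split: "length [i] + Suc (d - 2) = d" "length [i] + (d - 2) = d - 1" "Suc (length [i]) = 2"
      using d by auto
    have "runs_within
        (2 * (\<Sum>s = 1..<d - 1. max_slice_nnz n T s)
          + (d - 2) * ((4 * length Q + 2) * (m * n\<^sup>2) + 3 * n + 1))
        (\<lambda>_. True) (sample_modes n (gen (Suc t)) d Q (d - 2) 2 (slice T [i]))"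
      using sample_modes_cost_le[of n "[i]" "d - 2" T "gen (Suc t)" m Q, unfolded split] T gen
      by (auto simp: sketch_generator_def)
    moreover have "length Q \<le> k"
      using that Suc.prems by simp
    ultimately show ?thesis
      by (elim runs_within_mono) (intro add_mono mult_le_mono order_refl)
  qed
  have extend: "runs_within ?e (\<lambda>(Js, Q, w). length Q \<le> Suc t)
      (counted_run (extend n T {..<n} Y i (Js, Q, w)))"
    if "length Q \<le> t" for i Js Q w
  proof (rule runs_within_counted_run)
    have "snd (extend n T {..<n} Y i (Js, Q, w)) \<le> 4 * n * length Q + 4 * n + 1 + (4 * nnz Y + n)"
      using extend_bounds(1)[of "{..<n}" Y n T i Js Q w] Y(1) by simp
    also have "\<dots> \<le> ?e"
      using that Suc.prems Y(2) by (intro add_mono mult_le_mono order_refl) auto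
    finally show "snd (extend n T {..<n} Y i (Js, Q, w)) \<le> ?e" .
    show "case fst (extend n T {..<n} Y i (Js, Q, w)) of (Js, Q, w) \<Rightarrow> length Q \<le> Suc t"
      using extend_bounds(2)[of "{..<n}" Y n T i Js Q w] Y(1) that by (simp add: case_prod_unfold)
  qed
  have "runs_within (t * ?r + ((2 * card {..<n} + 1) + (?b + ?e))) (\<lambda>(Js, Q, w). length Q \<le> Suc t)
      (sketched_rounds n d T gen d Y ([], [], w) (Suc t))"
    unfolding sketched_rounds.simps
  proof (rule runs_within_bind[OF IH], clarify)
    fix Js and Q :: "(nat \<Rightarrow> real) list" and w :: "nat \<Rightarrow> real"
    assume Q: "length Q \<le> t"
    show "runs_within ((2 * card {..<n} + 1) + (?b + ?e)) (\<lambda>(Js, Q, w). length Q \<le> Suc t)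
        (do {
           i \<leftarrow> sample {..<n} {..<n} w;
           is \<leftarrow> sample_modes n (gen (Suc t)) d Q (d - 2) 2 (slice T [i]);
           counted_run (extend n T {..<n} Y (i # is) (Js, Q, w))
         })"
      by (intro runs_within_bind[OF runs_within_sample] runs_within_bind[OF modes[OF Q]] extend Q)
  qed
  then show ?case
    by (rule runs_within_mono) simp
qed

text \<open>
  Lower-order terms are absorbed into \<open>m n\<^sup>2 k\<^sup>2\<close>, which needs \<open>m \<ge> 1\<close>: a column of a sketch
  has its nonzero entry in one of the \<open>m\<close> rows, and \<open>n \<ge> 1\<close> guarantees that there is a column.
\<close>

lemma sketched_method_cost_le:
  assumes d: "2 \<le> d" and n: "1 \<le> n" and k: "1 \<le> k"
    and T: "cubic_tensor n d T" and gen: "sketch_generator m n d gen"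
  shows "runs_within
      (4 * nnz T + 2 * (k * (\<Sum>s = 1..d. max_slice_nnz n T s)) + 10 * d * (m * n\<^sup>2 * k\<^sup>2))
      (\<lambda>_. True) (sketched_method n d k T gen d)"
proof -
  let ?N = "max_slice_nnz n T"
  let ?round = "2 * n + 1
        + (2 * (\<Sum>s = 1..<d - 1. ?N s) + (d - 2) * ((4 * k + 2) * (m * n\<^sup>2) + 3 * n + 1))
        + (4 * n * k + 4 * n + 1 + (4 * (m * n\<^sup>2) + n))"
  have sketch: "runs_within 0 (count_sketch m n (d - 2)) (random_choice (gen 0 1))"
    using gen d unfolding sketch_generator_def
    by (intro runs_within_random_choice) (auto simp: numeral_2_eq_2 dest!: spec[of _ 1])
  have order: "Suc (Suc (d - 2)) = d"
    using d by simp
  have sketched: "runs_within (2 * nnz T)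
      (\<lambda>Y. finite {i. Y i \<noteq> 0} \<and> nnz Y \<le> m * n\<^sup>2 \<and> nnz Y \<le> nnz T) (counted_run (apply_sketch S T))"
    if "count_sketch m n (d - 2) S" for S
    using apply_sketch_bounds[OF that, unfolded order, OF T]
    by (intro runs_within_counted_run) auto
  have scores: "runs_within (2 * nnz T) (\<lambda>_. True) (counted_run (initial_scores {..<n} Y))"
    if "finite {i. Y i \<noteq> 0} \<and> nnz Y \<le> m * n\<^sup>2 \<and> nnz Y \<le> nnz T" for Y :: "nat \<times> nat \<times> nat \<Rightarrow> real"
    using initial_scores_cost_le[of "{..<n}" Y] that
    by (intro runs_within_counted_run) auto
  have rounds: "runs_within (k * ?round) (\<lambda>(Js, Q, w). length Q \<le> k)
      (sketched_rounds n d T gen d Y ([], [], w) k)"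
    if "finite {i. Y i \<noteq> 0} \<and> nnz Y \<le> m * n\<^sup>2 \<and> nnz Y \<le> nnz T" for Y w
    using that by (intro sketched_rounds_cost_le d T gen) auto
  have "runs_within (0 + (2 * nnz T + (2 * nnz T + (k * ?round + 0)))) (\<lambda>_. True)
      (sketched_method n d k T gen d)"
    unfolding sketched_method_def
    by (intro runs_within_bind[OF sketch] runs_within_bind[OF sketched]
        runs_within_bind[OF scores] runs_within_bind[OF rounds])
      (auto intro: runs_within_done_with)
  moreover have "k * ?round \<le> 2 * (k * (\<Sum>s = 1..d. ?N s)) + 10 * d * (m * n\<^sup>2 * k\<^sup>2)"
  proof -
    obtain S where S: "S \<in> set_pmf (gen 0 1)"
      using set_pmf_not_empty[of "gen 0 1"] by blast
    then have "count_sketch m n (d - 2) S"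
      using sketch by (auto simp: runs_within_def random_choice_def free_def)
    moreover have "replicate (d - 2) 0 \<in> multi_indices n (d - 2)"
      using n by (auto simp: multi_indices_def)
    ultimately have m: "1 \<le> m"
      unfolding count_sketch_def by fastforce
    define K where "K = k * (m * n\<^sup>2)"
    have n_le: "n \<le> m * n\<^sup>2"
      using m n by (simp add: power2_eq_square)
    have M_le: "m * n\<^sup>2 \<le> K"
      using k by (simp add: K_def)
    have nk_le: "n * k \<le> K"
      using n_le by (simp add: K_def mult.commute)
    have sums: "(\<Sum>s = 1..<d - 1. ?N s) \<le> (\<Sum>s = 1..d. ?N s)"
      by (rule sum_mono2) auto
    have "(4 * k + 2) * (m * n\<^sup>2) + 3 * n + 1 = 4 * K + 2 * (m * n\<^sup>2) + 3 * n + 1"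
      by (simp add: K_def algebra_simps)
    also have "\<dots> \<le> 10 * K"
      using n_le M_le n by linarith
    finally have "(d - 2) * ((4 * k + 2) * (m * n\<^sup>2) + 3 * n + 1) \<le> (d - 2) * (10 * K)"
      by (rule mult_le_mono2)
    moreover have "2 * n + 1 + (4 * n * k + 4 * n + 1 + (4 * (m * n\<^sup>2) + n)) \<le> 20 * K"
      using n_le M_le nk_le n by simp
    ultimately have "?round \<le> 2 * (\<Sum>s = 1..d. ?N s) + ((d - 2) * (10 * K) + 20 * K)"
      using sums by linarith
    also have "(d - 2) * (10 * K) + 20 * K = 10 * d * K"
      using d by (simp add: diff_mult_distrib)
    finally have "k * ?round \<le> k * (2 * (\<Sum>s = 1..d. ?N s) + 10 * d * K)"
      by (rule mult_le_mono2)
    then show ?thesis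
      by (simp add: K_def power2_eq_square algebra_simps)
  qed
  ultimately show ?thesis
    by (elim runs_within_mono) linarith
qed

lemma sampling_cost_le:
  assumes "2 \<le> d" "1 \<le> n" "1 \<le> k" "cubic_tensor n d T" "sketch_generator m n d gen"
    and "(J, cost) \<in> set_pmf (sketched_marginalized_norm_sampling n d k T gen)"
  shows "real cost \<le> 4 * real (nnz T) + 2 * (real k * (\<Sum>s = 1..d. real (max_slice_nnz n T s)))
           + 10 * real d * (real m * real n ^ 2 * real k ^ 2)"
proof -
  have "enat cost \<le> enat (4 * nnz T + 2 * (k * (\<Sum>s = 1..d. max_slice_nnz n T s))
      + 10 * d * (m * n\<^sup>2 * k\<^sup>2))"
    using order_trans[OF sampling_cost_le_unswitched[OF assms(1,6)]
        worst_case_cost_le[OF sketched_method_cost_le[OF assms(1-5)]]] by simp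
  then have "real cost \<le> real (4 * nnz T + 2 * (k * (\<Sum>s = 1..d. max_slice_nnz n T s))
      + 10 * d * (m * n\<^sup>2 * k\<^sup>2))"
    by (simp only: enat_ord_simps of_nat_le_iff)
  then show ?thesis
    by simp
qed


section \<open>The complexity of sketched marginalized norm sampling\<close>

theorem proposition3p4:
  fixes d :: nat
  assumes "2 \<le> d"
  shows "(\<forall>A::real. \<exists>C::real. \<forall>(n::nat) (k::nat) (m::nat) (T::tensor) (gen :: nat \<Rightarrow> nat \<Rightarrow> sketch pmf).
            1 \<le> n \<longrightarrow> 1 \<le> k \<longrightarrow> cubic_tensor n d T \<longrightarrow> sketch_generator m n d gen \<longrightarrow>
            real k * (\<Sum>s=1..d. real (max_slice_nnz n T s)) \<le> A * real (nnz T) \<longrightarrow>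
            (\<forall>(J, cost) \<in> set_pmf (sketched_marginalized_norm_sampling n d k T gen).
               real cost \<le> C * (real (nnz T) + real m * real n ^ 2 * real k ^ 2)))
       \<and> (\<exists>C::real. \<forall>(n::nat) (k::nat) (m::nat) (T::tensor) (gen :: nat \<Rightarrow> nat \<Rightarrow> sketch pmf).
            1 \<le> n \<longrightarrow> 1 \<le> k \<longrightarrow> cubic_tensor n d T \<longrightarrow> sketch_generator m n d gen \<longrightarrow>
            (\<forall>(J, cost) \<in> set_pmf (sketched_marginalized_norm_sampling n d k T gen).
               real cost \<le> C * (real (nnz T) + real k * (\<Sum>s=1..d. real (max_slice_nnz n T s))
                                + real m * real n ^ 2 * real k ^ 2)))"
proof (intro conjI allI)
  fix A :: real
  \<comment> \<open>The slice term is at most \<open>2 A N\<^sub>0\<close>, and \<open>d \<ge> 2\<close> lets \<open>10 d\<close> cover the coefficient 4 of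
    \<open>N\<^sub>0\<close>.\<close>
  let ?C = "10 * real d + 2 * \<bar>A\<bar>"
  show "\<exists>C::real. \<forall>(n::nat) (k::nat) (m::nat) (T::tensor) (gen :: nat \<Rightarrow> nat \<Rightarrow> sketch pmf).
            1 \<le> n \<longrightarrow> 1 \<le> k \<longrightarrow> cubic_tensor n d T \<longrightarrow> sketch_generator m n d gen \<longrightarrow>
            real k * (\<Sum>s=1..d. real (max_slice_nnz n T s)) \<le> A * real (nnz T) \<longrightarrow>
            (\<forall>(J, cost) \<in> set_pmf (sketched_marginalized_norm_sampling n d k T gen).
               real cost \<le> C * (real (nnz T) + real m * real n ^ 2 * real k ^ 2))"
  proof (rule exI[of _ ?C], clarify)
    fix n k m :: nat and T gen J cost
    let ?M = "real m * real n ^ 2 * real k ^ 2"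
    assume "1 \<le> n" "1 \<le> k" "cubic_tensor n d T" "sketch_generator m n d gen"
      and A2: "real k * (\<Sum>s=1..d. real (max_slice_nnz n T s)) \<le> A * real (nnz T)"
      and "(J, cost) \<in> set_pmf (sketched_marginalized_norm_sampling n d k T gen)"
    then have "real cost \<le> 4 * real (nnz T) + 2 * (A * real (nnz T)) + 10 * real d * ?M"
      using sampling_cost_le[OF assms, of n k T m gen J cost] by linarith
    also have "\<dots> = (4 + 2 * A) * real (nnz T) + 10 * real d * ?M"
      by (simp add: algebra_simps)
    also have "\<dots> \<le> ?C * real (nnz T) + ?C * ?M"
      using assms by (intro add_mono mult_right_mono) auto
    finally show "real cost \<le> ?C * (real (nnz T) + ?M)"
      by (simp add: distrib_left)
  qed
next
  let ?C = "10 * real d"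
  show "\<exists>C::real. \<forall>(n::nat) (k::nat) (m::nat) (T::tensor) (gen :: nat \<Rightarrow> nat \<Rightarrow> sketch pmf).
            1 \<le> n \<longrightarrow> 1 \<le> k \<longrightarrow> cubic_tensor n d T \<longrightarrow> sketch_generator m n d gen \<longrightarrow>
            (\<forall>(J, cost) \<in> set_pmf (sketched_marginalized_norm_sampling n d k T gen).
               real cost \<le> C * (real (nnz T) + real k * (\<Sum>s=1..d. real (max_slice_nnz n T s))
                                + real m * real n ^ 2 * real k ^ 2))"
  proof (rule exI[of _ ?C], clarify)
    fix n k m :: nat and T gen J cost
    let ?M = "real m * real n ^ 2 * real k ^ 2"
    let ?N = "real k * (\<Sum>s=1..d. real (max_slice_nnz n T s))"
    assume "1 \<le> n" "1 \<le> k" "cubic_tensor n d T" "sketch_generator m n d gen"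
      and "(J, cost) \<in> set_pmf (sketched_marginalized_norm_sampling n d k T gen)"
    then have "real cost \<le> 4 * real (nnz T) + 2 * ?N + 10 * real d * ?M"
      by (rule sampling_cost_le[OF assms])
    also have "\<dots> \<le> ?C * real (nnz T) + ?C * ?N + ?C * ?M"
      using assms by (intro add_mono mult_right_mono mult_nonneg_nonneg sum_nonneg) auto
    finally show "real cost \<le> ?C * (real (nnz T) + ?N + ?M)"
      by (simp add: distrib_left)
  qed
qed

end
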